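(* The primal-dual search-allocation algorithm described in the context, applied to any instance of the sparse multi-agent discrete search problem, constructs an optimal multi-agent search allocation; that is, its output $\{x_{mk}\}_{(m,k)\in\mathcal{A}}$ is an optimal solution of the problem of maximizing $\sum_{k=1}^K p_{k0}\bigl(1-(1-\alpha_k)^{u_k}\bigr)$ subject to $\sum_{m:(m,k)\in\mathcal{A}}x_{mk}=u_k$ for all $k$, $\sum_{k:(m,k)\in\mathcal{A}}x_{mk}=N_m$ for all $m$, and $x_{mk}\in\{0,1,\dots,N_m\}$ for all $(m,k)\in\mathcal{A}$.
   Context: **Problem.** There are $M$ agents and $K$ locations. $\mathcal{A}\subseteq\{1,\dots,M\}\times\{1,\dots,K\}$ is the set of accessibility pairs: $(m,k)\in\mathcal{A}$ iff agent $m$ can search location $k$. Every location is accessible by at least one agent and every agent can access at least one location. Agent $m$ has a budget of $N_m\in\{1,2,\dots\}$ searches, each search costing one unit; $N=\sum_{m=1}^M N_m$. A single stationary object is hidden in one of the locations; $p_{k0}$ is the prior probability that it is in location $k$, and $\alpha_k$ is the probability that a search of location $k$ (by any agent with access) finds the object if it is there; if it is not there the search always yields no detection. Outcomes are conditionally independent. For $j\ge 1$ let $p_{kj}=p_{k0}(1-\alpha_k)^{j-1}\alpha_k$. The sparse multi-agent discrete search problem is the maximization problem written in the claim, whose objective is the probability of finding the object when location $k$ is searched $u_k$ times. **Graph.** Source node $s_m$ represents agent $m$, sink node $t_k$ represents location $k$, and there is an arc $s_m\to t_k$ for each $(m,k)\in\mathcal{A}$, carrying flow $x_{mk}$. The variable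 $y_{kj}\in\{0,1\}$ records whether the $j$-th unit of demand at $t_k$ is satisfied. **Algorithm.** Input: $\mathcal{A}$, $N_m$, $p_{k0}$, $\alpha_k$ for all $m,k$. Output: $x_{mk}$ for all $(m,k)\in\mathcal{A}$. Initialization: all $x_{mk}=0$, all $y_{kj}=0$, no node is marked eliminated. Insert $-p_{k1}$, $k=1,\dots,K$, into a min-oriented binary heap $H$ (each entry remembers its $k$ and $j$). Set the available supply $R_m=N_m$ for $m=1,\dots,M$. Step 1. Repeat until $H$ is empty: extract the minimum entry $-p_{kj}$ from $H$. (a) If $t_k$ is marked eliminated, continue with the next iteration of Step 1. (b) Otherwise run Assign-Extra-Demand$(t_k)$ and let its returned value be $m$. (c) If $m>0$: decrement $R_m$ by 1, let $y_{kj}=1$, and compute and insert $-p_{k,j+1}$ into $H$. (d) Otherwise identify the source and sink nodes visited in that call as an isolated group, and mark them as eliminated. (e) Return to Step 1. Step 2. If $R_m=0$ for all $m$, identify the source and sink nodes never eliminated as an isolated group. Terminate. **Subroutine Assign-Extra-Demand$(t)$.** It works on the graph with eliminated nodes removed. Initialize a queue $Q$ containing only $t$, an empty set $V$ of visited nodes, and $pred(\cdot)=-1$ for all nodes. Step 1: remove the top element of $Q$. (a) If it is a sink $t_k$, check each source $s_m$ with $(m,k)\in\mathcal{A}$, $s_m\notin Q$, $s_m\notin V$. If $R_m>0$, an augmenting path has been found: set $pred(s_m)=t_k$ and go to Step 3. Otherwise add $s_m$ to $Q$ and set $pred(s_m)=t_k$. Add $t_k$ to $V$ and continue. (b) If it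 is a source $s_m$ (with $R_m=0$), find each sink $t_k$ with $(m,k)\in\mathcal{A}$, $x_{mk}>0$, $t_k\notin Q$, $t_k\notin V$; add each such $t_k$ to $Q$ and set $pred(t_k)=s_m$. Add $s_m$ to $V$ and continue. Step 2: if $Q$ is not empty, return to Step 1. Otherwise mark all nodes in $V$ as eliminated, shrink the graph by removing them, and return $-1$. Step 3: set $m^*=m$ for the source $s_m$ just found. Starting from $s_m$, augment recursively: (i) for a source $s_m$, let $t_k=pred(s_m)$ and increment $x_{mk}$ by 1; (ii) for the sink $t_k$, if $pred(t_k)=-1$, finish; otherwise let $s_m=pred(t_k)$, decrement $x_{mk}$ by 1, and go to (i) with this $s_m$. Return $m^*$. *)

theory Defs
  imports Complex_Main "HOL-Library.Multiset"
begin

datatype node = Source nat | Sink nat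

text \<open>
  Control points of the algorithm.  A call of the subroutine Assign-Extra-Demand is made for a
  heap entry \<open>(k, j)\<close>, which is carried along until the call returns; \<open>m0\<close> below is the source
  with positive supply found by the search.
  \<^item> \<open>Main\<close>: head of the main loop;
  \<^item> \<open>Search k j\<close>: breadth-first search of the subroutine;
  \<^item> \<open>AugSource k j m0 m\<close> and \<open>AugSink k j m0 k'\<close>: augmentation along the path found, now at source \<open>m\<close>,
    respectively sink \<open>k'\<close>;
  \<^item> \<open>Return k j r\<close>: back in the main loop with result \<open>r\<close>, where \<open>None\<close> stands for the return
    value \<open>-1\<close>;
  \<^item> \<open>Halted\<close>: the algorithm has terminated.
\<close>

datatype control =
    Main
  | Search nat nat
  | AugSource nat nat nat nat
  | AugSink nat nat nat nat
  | Return nat nat "nat option"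
  | Halted

text \<open>
  \<open>flow\<close>, \<open>demand\<close> and \<open>avail\<close> are $x$, $y$ and $R$; the fields \<open>queue\<close>, \<open>visited\<close> and \<open>pred\<close>
  are $Q$, $V$ and $pred$, local to a call of the subroutine (\<open>None\<close> is the predecessor \<open>-1\<close>).
  An entry \<open>(k, j)\<close> of the heap stands for the number $-p_{kj}$.
\<close>

record state =
  flow :: "nat \<Rightarrow> nat \<Rightarrow> nat"
  demand :: "nat \<Rightarrow> nat \<Rightarrow> nat"
  avail :: "nat \<Rightarrow> nat"
  eliminated :: "node set"
  groups :: "node set set"
  heap :: "(nat \<times> nat) multiset"
  queue :: "node list"
  visited :: "node set"
  pred :: "node \<Rightarrow> node option"
  pc :: control

definition set_pred :: "node \<Rightarrow> node list \<Rightarrow> (node \<Rightarrow> node option) \<Rightarrow> (node \<Rightarrow> node option)" where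
  "set_pred t ns pr = (\<lambda>v. if v \<in> set ns then Some t else pr v)"

definition inc_at :: "nat \<Rightarrow> nat \<Rightarrow> (nat \<Rightarrow> nat \<Rightarrow> nat) \<Rightarrow> (nat \<Rightarrow> nat \<Rightarrow> nat)" where
  "inc_at m k x = x(m := (x m)(k := x m k + 1))"

definition dec_at :: "nat \<Rightarrow> nat \<Rightarrow> (nat \<Rightarrow> nat \<Rightarrow> nat) \<Rightarrow> (nat \<Rightarrow> nat \<Rightarrow> nat)" where
  "dec_at m k x = x(m := (x m)(k := x m k - 1))"

locale search_problem =
  fixes M K :: nat
    and A :: "(nat \<times> nat) set"
    and N :: "nat \<Rightarrow> nat"
    and p0 :: "nat \<Rightarrow> real"
    and \<alpha> :: "nat \<Rightarrow> real"
  assumes access_subset: "A \<subseteq> {1..M} \<times> {1..K}"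
    and location_accessible: "k \<in> {1..K} \<Longrightarrow> \<exists>m. (m, k) \<in> A"
    and agent_has_access: "m \<in> {1..M} \<Longrightarrow> \<exists>k. (m, k) \<in> A"
    and budget_pos: "m \<in> {1..M} \<Longrightarrow> N m \<ge> 1"
    and prior_nonneg: "k \<in> {1..K} \<Longrightarrow> p0 k \<ge> 0"
    and prior_sum: "(\<Sum>k = 1..K. p0 k) = 1"
    and detection_prob: "k \<in> {1..K} \<Longrightarrow> 0 \<le> \<alpha> k \<and> \<alpha> k \<le> 1"
begin

definition objective :: "(nat \<Rightarrow> nat) \<Rightarrow> real" where
  "objective u = (\<Sum>k = 1..K. p0 k * (1 - (1 - \<alpha> k) ^ u k))"

definition feasible :: "(nat \<Rightarrow> nat \<Rightarrow> nat) \<Rightarrow> (nat \<Rightarrow> nat) \<Rightarrow> bool" where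
  "feasible x u \<longleftrightarrow>
     (\<forall>k\<in>{1..K}. (\<Sum>m | (m, k) \<in> A. x m k) = u k) \<and>
     (\<forall>m\<in>{1..M}. (\<Sum>k | (m, k) \<in> A. x m k) = N m) \<and>
     (\<forall>(m, k)\<in>A. x m k \<in> {0..N m})"

definition optimal_allocation :: "(nat \<Rightarrow> nat \<Rightarrow> nat) \<Rightarrow> bool" where
  "optimal_allocation x \<longleftrightarrow>
     (\<exists>u. feasible x u \<and> (\<forall>x' u'. feasible x' u' \<longrightarrow> objective u' \<le> objective u))"

definition p :: "nat \<Rightarrow> nat \<Rightarrow> real" where
  "p k j = p0 k * (1 - \<alpha> k) ^ (j - 1) * \<alpha> k"

fun key :: "nat \<times> nat \<Rightarrow> real" where
  "key (k, j) = - p k j"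

definition initial :: state where
  "initial = \<lparr>flow = (\<lambda>_ _. 0), demand = (\<lambda>_ _. 0), avail = N,
     eliminated = {}, groups = {}, heap = image_mset (\<lambda>k. (k, 1)) (mset_set {1..K}),
     queue = [], visited = {}, pred = (\<lambda>_. None), pc = Main\<rparr>"

definition is_min :: "nat \<times> nat \<Rightarrow> (nat \<times> nat) multiset \<Rightarrow> bool" where
  "is_min e H \<longleftrightarrow> e \<in># H \<and> (\<forall>e'\<in>#H. key e \<le> key e')"

definition new_sources :: "state \<Rightarrow> nat \<Rightarrow> node list \<Rightarrow> nat set" where
  "new_sources s k q = {m. (m, k) \<in> A \<and> Source m \<notin> eliminated s \<and>
     Source m \<notin> set q \<and> Source m \<notin> visited s}"

definition new_sinks :: "state \<Rightarrow> nat \<Rightarrow> node list \<Rightarrow> nat set" where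
  "new_sinks s m q = {k. (m, k) \<in> A \<and> Sink k \<notin> eliminated s \<and> flow s m k > 0 \<and>
     Sink k \<notin> set q \<and> Sink k \<notin> visited s}"

definition nodes :: "node set" where
  "nodes = Source ` {1..M} \<union> Sink ` {1..K}"

text \<open>
  The algorithm leaves open how ties in the heap are broken and in which order the neighbours of
  a node are checked.  Both choices are nondeterministic here: \<open>is_min\<close> admits any minimum entry,
  and the lists \<open>ms\<close>, \<open>ks\<close> below range over all orderings of the neighbours.  The premises
  \<open>flow s m k' > 0\<close> and \<open>avail s m > 0\<close> in front of the decrements keep the truncated subtraction
  of natural numbers from hiding a negative value: such a decrement would block the execution.
\<close>

inductive step :: "state \<Rightarrow> state \<Rightarrow> bool" where
  skip_eliminated:
    "\<lbrakk>pc s = Main; is_min (k, j) (heap s); Sink k \<in> eliminated s\<rbrakk>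
     \<Longrightarrow> step s (s\<lparr>heap := heap s - {#(k, j)#}\<rparr>)"
| call:
    "\<lbrakk>pc s = Main; is_min (k, j) (heap s); Sink k \<notin> eliminated s\<rbrakk>
     \<Longrightarrow> step s (s\<lparr>heap := heap s - {#(k, j)#},
           queue := [Sink k], visited := {}, pred := (\<lambda>_. None), pc := Search k j\<rparr>)"
| search_sink_found:
    "\<lbrakk>pc s = Search k j; queue s = Sink k' # q;
      distinct (ms @ m # ms'); set (ms @ m # ms') = new_sources s k' q;
      \<forall>m'\<in>set ms. avail s m' = 0; avail s m > 0\<rbrakk>
     \<Longrightarrow> step s (s\<lparr>queue := q @ map Source ms,
           pred := set_pred (Sink k') (map Source (ms @ [m])) (pred s),
           pc := AugSource k j m m\<rparr>)"
| search_sink: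
    "\<lbrakk>pc s = Search k j; queue s = Sink k' # q;
      distinct ms; set ms = new_sources s k' q; \<forall>m\<in>set ms. avail s m = 0\<rbrakk>
     \<Longrightarrow> step s (s\<lparr>queue := q @ map Source ms,
           pred := set_pred (Sink k') (map Source ms) (pred s),
           visited := insert (Sink k') (visited s)\<rparr>)"
| search_source:
    "\<lbrakk>pc s = Search k j; queue s = Source m # q; distinct ks; set ks = new_sinks s m q\<rbrakk>
     \<Longrightarrow> step s (s\<lparr>queue := q @ map Sink ks,
           pred := set_pred (Source m) (map Sink ks) (pred s),
           visited := insert (Source m) (visited s)\<rparr>)"
| search_fail:
    "\<lbrakk>pc s = Search k j; queue s = []\<rbrakk>
     \<Longrightarrow> step s (s\<lparr>eliminated := eliminated s \<union> visited s, pc := Return k j None\<rparr>)"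
| augment_source:
    "\<lbrakk>pc s = AugSource k j m0 m; pred s (Source m) = Some (Sink k')\<rbrakk>
     \<Longrightarrow> step s (s\<lparr>flow := inc_at m k' (flow s), pc := AugSink k j m0 k'\<rparr>)"
| augment_sink_end:
    "\<lbrakk>pc s = AugSink k j m0 k'; pred s (Sink k') = None\<rbrakk>
     \<Longrightarrow> step s (s\<lparr>pc := Return k j (Some m0)\<rparr>)"
| augment_sink:
    "\<lbrakk>pc s = AugSink k j m0 k'; pred s (Sink k') = Some (Source m); flow s m k' > 0\<rbrakk>
     \<Longrightarrow> step s (s\<lparr>flow := dec_at m k' (flow s), pc := AugSource k j m0 m\<rparr>)"
| return_found:
    "\<lbrakk>pc s = Return k j (Some m); avail s m > 0\<rbrakk>
     \<Longrightarrow> step s (s\<lparr>avail := (avail s)(m := avail s m - 1),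
           demand := (demand s)(k := (demand s k)(j := 1)),
           heap := heap s + {#(k, j + 1)#}, pc := Main\<rparr>)"
| return_none:
    "pc s = Return k j None
     \<Longrightarrow> step s (s\<lparr>groups := insert (visited s) (groups s),
           eliminated := eliminated s \<union> visited s, pc := Main\<rparr>)"
| halt:
    "\<lbrakk>pc s = Main; heap s = {#}\<rbrakk>
     \<Longrightarrow> step s (s\<lparr>groups := (if \<forall>m\<in>{1..M}. avail s m = 0
           then groups s \<union> ({nodes - eliminated s} - {{}}) else groups s), pc := Halted\<rparr>)"

end

end

theory Submission imports Defs begin

text \<open>
  The problem is a transportation problem with a separable concave objective, and the algorithm is a
  greedy primal-dual method: the order of elimination produces optimal dual prices. The extracted
  values \<open>p k j\<close> never increase, since \<open>p k j\<close> is nonincreasing in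
  \<open>j\<close>. Let \<open>c\<close> be the value for which the latest call of the search was
  made. When a search fails, every visited node is eliminated and receives the price
  \<open>c\<close>. A location \<open>k\<close> that is eliminated with \<open>u k\<close> units
  then satisfies \<open>p k (u k + 1) \<le> price \<le> p k (u k)\<close> (the second part if
  \<open>u k > 0\<close>): earlier units were bought while the value was at least \<open>c\<close>,
  and the next unit is the extracted one or still waits in the heap. The search visits all remaining
  agents with access to a visited location, so an agent is eliminated no later than its locations
  and its price is at least theirs. It also follows all positive flow backwards, so the prices agree
  wherever flow is positive. These are the complementary slackness conditions, and
  \<open>optimal_by_prices\<close> turns them into optimality by bounding each concave gain by its
  tangent.

  That an execution preserves these facts is \<open>invariant_step\<close>. Its invariant existentially
  quantifies over quantities that the state does not store: the prices, the numbers \<open>u\<close> of bought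
  units, and the set of locations that own a heap entry. The part of the augmenting path that is
  still ahead is instead an argument of the invariant, because its length is needed in the
  lexicographic rank that decreases with every step: remaining supply, heap size, control point, and
  then the number of unvisited nodes (during a search) or the remaining path (during an
  augmentation). So no run is infinite. By \<open>step_exists\<close> a run gets stuck only in \<open>Halted\<close>, and there
  the heap is empty, so every location has been eliminated, hence every agent too, and an eliminated
  agent has exhausted its budget.
\<close>

context search_problem
begin

section \<open>Sums over accessibility pairs\<close>

lemma finite_A [simp]: "finite A"
  using access_subset by (rule finite_subset) simp

lemma finite_sources [simp]: "finite {m. (m, k) \<in> A}"
  by (rule finite_subset[of _ "fst ` A"]) (auto simp: image_iff, force)

lemma finite_sinks [simp]: "finite {k. (m, k) \<in> A}"
  by (rule finite_subset[of _ "snd ` A"]) (auto simp: image_iff, force)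

lemma access_bounds: "(m, k) \<in> A \<Longrightarrow> m \<in> {1..M} \<and> k \<in> {1..K}"
  using access_subset by auto

lemma finite_nodes [simp]: "finite nodes"
  by (simp add: nodes_def)

lemma sum_by_location:
  "(\<Sum>k = 1..K. \<Sum>m | (m, k) \<in> A. f m k) = (\<Sum>(m, k)\<in>A. f m k)"
proof -
  have "(\<Sum>k = 1..K. \<Sum>m | (m, k) \<in> A. f m k)
      = (\<Sum>(k, m)\<in>Sigma {1..K} (\<lambda>k. {m. (m, k) \<in> A}). f m k)"
    by (rule sum.Sigma) auto
  also have "\<dots> = (\<Sum>(m, k)\<in>A. f m k)"
    by (rule sum.reindex_bij_witness[of _ prod.swap prod.swap]) (use access_bounds in auto)
  finally show ?thesis .
qed

lemma sum_by_agent: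
  "(\<Sum>m = 1..M. \<Sum>k | (m, k) \<in> A. f m k) = (\<Sum>(m, k)\<in>A. f m k)"
proof -
  have "(\<Sum>m = 1..M. \<Sum>k | (m, k) \<in> A. f m k)
      = (\<Sum>(m, k)\<in>Sigma {1..M} (\<lambda>m. {k. (m, k) \<in> A}). f m k)"
    by (rule sum.Sigma) auto
  also have "Sigma {1..M} (\<lambda>m. {k. (m, k) \<in> A}) = A"
    using access_bounds by auto
  finally show ?thesis .
qed

section \<open>Optimality from dual prices\<close>

definition gain :: "nat \<Rightarrow> nat \<Rightarrow> real" where
  "gain k n = p0 k * (1 - (1 - \<alpha> k) ^ n)"

lemma gain_Suc: "gain k (Suc n) = gain k n + p k (Suc n)"
  by (simp add: gain_def p_def algebra_simps)

lemma p_antimono: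
  assumes "k \<in> {1..K}" "i \<le> j"
  shows "p k j \<le> p k i"
proof -
  have "(1 - \<alpha> k) ^ (j - 1) \<le> (1 - \<alpha> k) ^ (i - 1)"
    using detection_prob[OF assms(1)] assms(2) by (intro power_decreasing) auto
  then show ?thesis
    unfolding p_def using detection_prob[OF assms(1)] prior_nonneg[OF assms(1)]
    by (intro mult_right_mono mult_left_mono) auto
qed

text \<open>
  A price between two consecutive increments of a concave sequence is a supergradient at that point.
\<close>

lemma gain_tangent:
  assumes k: "k \<in> {1..K}"
    and next_le: "p k (Suc n) \<le> l"
    and last_ge: "n > 0 \<Longrightarrow> l \<le> p k n"
  shows "gain k n' \<le> gain k n + l * (real n' - real n)"
proof (cases "n \<le> n'")
  case True
  then show ?thesis
  proof (induction n' rule: dec_induct)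
    case (step i)
    have "p k (Suc i) \<le> l"
      using p_antimono[OF k, of "Suc n" "Suc i"] step.hyps next_le by simp
    then show ?case
      using step.IH by (simp add: gain_Suc algebra_simps)
  qed simp
next
  case False
  then have "n' \<le> n" by simp
  then show ?thesis
  proof (induction n' rule: inc_induct)
    case (step i)
    have "l \<le> p k (Suc i)"
      using p_antimono[OF k, of "Suc i" n] step.hyps last_ge by simp
    then show ?case
      using step.IH by (simp add: gain_Suc algebra_simps)
  qed simp
qed

text \<open>
  Weak duality with complementary slackness. The tangent bound charges a competitor \<open>u'\<close> the amount
  \<open>lt k\<close> per unit at location \<open>k\<close>. Charging the agents' prices \<open>ls m\<close> instead costs at least as
  much, for \<open>x\<close> it costs the same, and the agents' total charge is fixed by the budgets.
\<close>

lemma optimal_by_prices: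
  fixes ls lt :: "nat \<Rightarrow> real"
  assumes feas: "feasible x u"
    and price_le: "\<And>m k. (m, k) \<in> A \<Longrightarrow> lt k \<le> ls m"
    and price_tight: "\<And>m k. (m, k) \<in> A \<Longrightarrow> x m k > 0 \<Longrightarrow> ls m \<le> lt k"
    and next_le: "\<And>k. k \<in> {1..K} \<Longrightarrow> p k (Suc (u k)) \<le> lt k"
    and last_ge: "\<And>k. k \<in> {1..K} \<Longrightarrow> u k > 0 \<Longrightarrow> lt k \<le> p k (u k)"
  shows "optimal_allocation x"
proof -
  have value_eq: "(\<Sum>k = 1..K. lt k * real (v k)) = (\<Sum>(m, k)\<in>A. lt k * real (y m k))"
    and supply_eq: "(\<Sum>(m, k)\<in>A. ls m * real (y m k)) = (\<Sum>m = 1..M. ls m * real (N m))"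
    if y: "feasible y v" for y v
  proof -
    have "(\<Sum>k = 1..K. lt k * real (v k)) = (\<Sum>k = 1..K. \<Sum>m | (m, k) \<in> A. lt k * real (y m k))"
      using y by (intro sum.cong refl) (auto simp: feasible_def sum_distrib_left[symmetric]
          simp flip: of_nat_sum)
    then show "(\<Sum>k = 1..K. lt k * real (v k)) = (\<Sum>(m, k)\<in>A. lt k * real (y m k))"
      unfolding sum_by_location .
    have "(\<Sum>m = 1..M. ls m * real (N m)) = (\<Sum>m = 1..M. \<Sum>k | (m, k) \<in> A. ls m * real (y m k))"
      using y by (intro sum.cong refl) (auto simp: feasible_def sum_distrib_left[symmetric]
          simp flip: of_nat_sum)
    then show "(\<Sum>(m, k)\<in>A. ls m * real (y m k)) = (\<Sum>m = 1..M. ls m * real (N m))"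
      unfolding sum_by_agent by (rule sym)
  qed
  have "objective u' \<le> objective u" if y: "feasible x' u'" for x' u'
  proof -
    have "objective u' = (\<Sum>k = 1..K. gain k (u' k))"
      by (simp add: objective_def gain_def)
    also have "\<dots> \<le> (\<Sum>k = 1..K. gain k (u k) + lt k * (real (u' k) - real (u k)))"
      using next_le last_ge by (intro sum_mono gain_tangent) auto
    also have "\<dots> = objective u + (\<Sum>k = 1..K. lt k * real (u' k)) - (\<Sum>k = 1..K. lt k * real (u k))"
      by (simp add: objective_def gain_def algebra_simps sum.distrib sum_subtractf)
    also have "(\<Sum>k = 1..K. lt k * real (u k)) = (\<Sum>(m, k)\<in>A. ls m * real (x m k))"
      unfolding value_eq[OF feas]
    proof (intro sum.cong refl, clarify)
      fix m k assume "(m, k) \<in> A"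
      then show "lt k * real (x m k) = ls m * real (x m k)"
        using price_le[of m k] price_tight[of m k] by (cases "x m k = 0") auto
    qed
    also have "(\<Sum>k = 1..K. lt k * real (u' k)) \<le> (\<Sum>(m, k)\<in>A. ls m * real (x' m k))"
      unfolding value_eq[OF y] by (intro sum_mono) (auto intro!: mult_right_mono price_le)
    finally show ?thesis
      by (simp add: supply_eq[OF feas] supply_eq[OF y])
  qed
  then show ?thesis
    using feas by (auto simp: optimal_allocation_def)
qed

section \<open>Flow balance\<close>

definition outflow :: "(nat \<Rightarrow> nat \<Rightarrow> nat) \<Rightarrow> nat \<Rightarrow> nat" where
  "outflow x m = (\<Sum>k | (m, k) \<in> A. x m k)"

definition inflow :: "(nat \<Rightarrow> nat \<Rightarrow> nat) \<Rightarrow> nat \<Rightarrow> nat" where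
  "inflow x k = (\<Sum>m | (m, k) \<in> A. x m k)"

lemma outflow_inc:
  assumes "(m, k) \<in> A"
  shows "outflow (inc_at m k x) m' = outflow x m' + of_bool (m' = m)"
proof -
  have "outflow (inc_at m k x) m' =
      (\<Sum>k' | (m', k') \<in> A. x m' k' + (if k' = k then of_bool (m' = m) else 0))"
    unfolding outflow_def by (rule sum.cong) (auto simp: inc_at_def)
  also have "\<dots> = outflow x m' + of_bool (m' = m)"
    using assms by (auto simp: sum.distrib outflow_def sum.delta)
  finally show ?thesis .
qed

lemma inflow_inc:
  assumes "(m, k) \<in> A"
  shows "inflow (inc_at m k x) k' = inflow x k' + of_bool (k' = k)"
proof -
  have "inflow (inc_at m k x) k' =
      (\<Sum>m' | (m', k') \<in> A. x m' k' + (if m' = m then of_bool (k' = k) else 0))"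
    unfolding inflow_def by (rule sum.cong) (auto simp: inc_at_def)
  also have "\<dots> = inflow x k' + of_bool (k' = k)"
    using assms by (auto simp: sum.distrib inflow_def sum.delta)
  finally show ?thesis .
qed

lemma inc_dec: "x m k > 0 \<Longrightarrow> inc_at m k (dec_at m k x) = x"
  by (auto simp: inc_at_def dec_at_def fun_eq_iff)

lemma outflow_dec:
  assumes "(m, k) \<in> A" "x m k > 0"
  shows "outflow x m' = outflow (dec_at m k x) m' + of_bool (m' = m)"
  using outflow_inc[OF assms(1), of "dec_at m k x" m'] inc_dec[of x m k, OF assms(2)] by simp

lemma inflow_dec:
  assumes "(m, k) \<in> A" "x m k > 0"
  shows "inflow x k' = inflow (dec_at m k x) k' + of_bool (k' = k)"
  using inflow_inc[OF assms(1), of "dec_at m k x" k'] inc_dec[of x m k, OF assms(2)] by simp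

text \<open>
  In the middle of an augmentation, conservation of flow is off by one unit at up to three nodes:
  agents in \<open>P\<close> have shipped one unit too few, agents in \<open>Q\<close> one too many, and locations in
  \<open>R\<close> have received one unit more than \<open>u\<close> records.
\<close>

definition balanced ::
  "(nat \<Rightarrow> nat) \<Rightarrow> nat set \<Rightarrow> nat set \<Rightarrow> nat set \<Rightarrow> state \<Rightarrow> bool" where
  "balanced u P Q R s \<longleftrightarrow>
     (\<forall>m. outflow (flow s) m + avail s m + of_bool (m \<in> P) = N m + of_bool (m \<in> Q)) \<and>
     (\<forall>k. inflow (flow s) k = u k + of_bool (k \<in> R))"

section \<open>Invariants\<close>

text \<open>
  The prices \<open>\<pi>\<close> are only meaningful on eliminated nodes. A location that is still active has
  no price yet, but a later price will be at most the current value \<open>c\<close>; this is why \<open>c\<close> stands in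
  for its price in the last condition.
\<close>

definition certified :: "(nat \<Rightarrow> nat) \<Rightarrow> (node \<Rightarrow> real) \<Rightarrow> real \<Rightarrow> state \<Rightarrow> bool" where
  "certified u \<pi> c s \<longleftrightarrow>
     (\<forall>(m, k)\<in>A. Sink k \<in> eliminated s \<longrightarrow>
        Source m \<in> eliminated s \<and> \<pi> (Sink k) \<le> \<pi> (Source m)) \<and>
     (\<forall>(m, k)\<in>A. Source m \<in> eliminated s \<longrightarrow> flow s m k > 0 \<longrightarrow>
        Sink k \<in> eliminated s \<and> \<pi> (Source m) \<le> \<pi> (Sink k)) \<and>
     (\<forall>v\<in>eliminated s. c \<le> \<pi> v) \<and>
     (\<forall>m. Source m \<in> eliminated s \<longrightarrow> avail s m = 0) \<and>
     (\<forall>k\<in>{1..K}. Sink k \<in> eliminated s \<longrightarrow> p k (Suc (u k)) \<le> \<pi> (Sink k)) \<and>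
     (\<forall>k\<in>{1..K}. u k > 0 \<longrightarrow> (if Sink k \<in> eliminated s then \<pi> (Sink k) else c) \<le> p k (u k))"

text \<open>
  No location owns two heap entries, and an entry always offers the first unit that is not yet bought;
  the indexing by a set \<open>S\<close> of locations states both.
\<close>

definition entries :: "(nat \<Rightarrow> nat) \<Rightarrow> nat set \<Rightarrow> (nat \<times> nat) multiset" where
  "entries u S = image_mset (\<lambda>k. (k, Suc (u k))) (mset_set S)"

text \<open>
  Locations that were eliminated through another location's search leave a stale entry behind, so
  \<open>S\<close> may be larger than the set of active locations.
\<close>

definition competing :: "nat set \<Rightarrow> (nat \<Rightarrow> nat) \<Rightarrow> real \<Rightarrow> state \<Rightarrow> bool" where
  "competing S u c s \<longleftrightarrow>
     S \<subseteq> {1..K} \<and> {k \<in> {1..K}. Sink k \<notin> eliminated s} \<subseteq> S \<and> (\<forall>k\<in>S. p k (Suc (u k)) \<le> c)"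

definition ready :: "nat set \<Rightarrow> (nat \<Rightarrow> nat) \<Rightarrow> real \<Rightarrow> state \<Rightarrow> bool" where
  "ready S u c s \<longleftrightarrow> competing S u c s \<and> heap s = entries u S"

text \<open>
  During a call for location \<open>k\<close> its entry is out of the heap, but \<open>k\<close> stays in \<open>S\<close>: the bound
  on its next unit is still required if the search fails.
\<close>

definition serving :: "nat \<Rightarrow> nat \<Rightarrow> nat set \<Rightarrow> (nat \<Rightarrow> nat) \<Rightarrow> real \<Rightarrow> state \<Rightarrow> bool" where
  "serving k j S u c s \<longleftrightarrow> competing S u c s \<and> heap s = entries u (S - {k}) \<and>
     k \<in> S \<and> Sink k \<notin> eliminated s \<and> j = Suc (u k) \<and> c = p k j"

text \<open>
  A chain of predecessors from a reached node to the root \<open>k\<close>. Repeated nodes are excluded so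
  that augmenting along a prefix of the chain leaves positive flow on the rest of it.
\<close>

inductive search_path ::
  "(node \<Rightarrow> node option) \<Rightarrow> (nat \<Rightarrow> nat \<Rightarrow> nat) \<Rightarrow> nat \<Rightarrow> node list \<Rightarrow> bool"
  for pr x k where
  root: "pr (Sink k) = None \<Longrightarrow> search_path pr x k [Sink k]"
| source: "\<lbrakk>search_path pr x k (Sink k' # vs); pr (Source m) = Some (Sink k'); (m, k') \<in> A;
    Source m \<notin> set vs\<rbrakk> \<Longrightarrow> search_path pr x k (Source m # Sink k' # vs)"
| sink: "\<lbrakk>search_path pr x k (Source m # vs); pr (Sink k') = Some (Source m); (m, k') \<in> A;
    x m k' > 0; Sink k' \<notin> set vs\<rbrakk> \<Longrightarrow> search_path pr x k (Sink k' # Source m # vs)"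

inductive_cases search_path_SourceE: "search_path pr x k (Source m # vs)"
inductive_cases search_path_SinkE: "search_path pr x k (Sink k' # vs)"

text \<open>
  A path survives the extension of the search tree by new nodes, and the changes of flow that
  augmentation makes behind the current node.
\<close>

lemma search_path_cong:
  assumes "search_path pr x k vs"
    and "\<And>v. v \<in> set vs \<Longrightarrow> pr' v = pr v"
    and "\<And>m k'. Sink k' \<in> set vs \<Longrightarrow> x m k' > 0 \<Longrightarrow> x' m k' > 0"
  shows "search_path pr' x' k vs"
  using assms by induction (auto intro!: search_path.intros)

definition reached :: "state \<Rightarrow> node set" where
  "reached s = set (queue s) \<union> visited s"

text \<open>
  The two closure conditions concern \<open>visited\<close> nodes only, whose neighbours have all been
  checked. When the queue is empty they make the visited set closed under the residual arcs that
  avoid eliminated nodes.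
\<close>

definition searching :: "nat \<Rightarrow> state \<Rightarrow> bool" where
  "searching k s \<longleftrightarrow>
     distinct (queue s) \<and> set (queue s) \<inter> visited s = {} \<and>
     reached s \<subseteq> nodes - eliminated s \<and> Sink k \<in> reached s \<and>
     (\<forall>m. Source m \<in> reached s \<longrightarrow> avail s m = 0) \<and>
     (\<forall>(m, k')\<in>A. Sink k' \<in> visited s \<longrightarrow> Source m \<in> reached s \<union> eliminated s) \<and>
     (\<forall>(m, k')\<in>A. Source m \<in> visited s \<longrightarrow> flow s m k' > 0 \<longrightarrow>
        Sink k' \<in> reached s \<union> eliminated s) \<and>
     (\<forall>v\<in>reached s. \<exists>vs. search_path (pred s) (flow s) k (v # vs) \<and> set vs \<subseteq> reached s)"

definition augmenting :: "nat \<Rightarrow> node list \<Rightarrow> state \<Rightarrow> bool" where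
  "augmenting k vs s \<longleftrightarrow>
     search_path (pred s) (flow s) k vs \<and> set vs \<inter> eliminated s = {}"

text \<open>
  Before the first arc is augmented, \<open>AugSource\<close> is at \<open>m = m0\<close>, where the surplus in \<open>{m0}\<close> and
  the deficit in \<open>{m}\<close> cancel; afterwards they are the two ends of the part already augmented.
\<close>

definition invariant :: "node list \<Rightarrow> state \<Rightarrow> bool" where
  "invariant vs s \<longleftrightarrow> (\<exists>S u \<pi> c. certified u \<pi> c s \<and>
     (case pc s of
       Main \<Rightarrow> ready S u c s \<and> balanced u {} {} {} s
     | Search k j \<Rightarrow> serving k j S u c s \<and> balanced u {} {} {} s \<and> searching k s
     | AugSource k j m0 m \<Rightarrow> serving k j S u c s \<and> balanced u {m} {m0} {} s \<and> m0 \<in> {1..M} \<and> avail s m0 > 0 \<and>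
         hd vs = Source m \<and> augmenting k vs s
     | AugSink k j m0 k' \<Rightarrow> serving k j S u c s \<and> balanced u {} {m0} {k'} s \<and> m0 \<in> {1..M} \<and> avail s m0 > 0 \<and>
         hd vs = Sink k' \<and> augmenting k vs s
     | Return k j r \<Rightarrow> (case r of
           None \<Rightarrow> ready S u c s \<and> balanced u {} {} {} s \<and> visited s \<subseteq> eliminated s
         | Some m \<Rightarrow> serving k j S u c s \<and> balanced u {} {m} {k} s \<and> m \<in> {1..M} \<and> avail s m > 0)
     | Halted \<Rightarrow> ready S u c s \<and> balanced u {} {} {} s \<and> heap s = {#}))"

fun phase :: "control \<Rightarrow> nat" where
  "phase Halted = 0"
| "phase Main = 1"
| "phase (Return k j r) = 2"
| "phase (AugSink k j m0 k') = 3"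
| "phase (AugSource k j m0 m) = 3"
| "phase (Search k j) = 4"

definition inner_rank :: "node list \<Rightarrow> state \<Rightarrow> nat" where
  "inner_rank vs s = (case pc s of Search k j \<Rightarrow> card (nodes - visited s) | _ \<Rightarrow> length vs)"

definition progress_rel :: "((node list \<times> state) \<times> (node list \<times> state)) set" where
  "progress_rel = measures
     [\<lambda>(vs, s). \<Sum>m = 1..M. avail s m, \<lambda>(vs, s). size (heap s),
      \<lambda>(vs, s). phase (pc s), \<lambda>(vs, s). inner_rank vs s]"

text \<open>
  Any bound on all first-unit probabilities can serve as the initial value \<open>c\<close>; it need not be a key.
\<close>

lemma invariant_initial: "invariant [] initial"
proof -
  have "p k (Suc 0) \<le> 1" if "k \<in> {1..K}" for k
  proof -
    have "p0 k \<le> (\<Sum>k = 1..K. p0 k)"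
      using that prior_nonneg by (intro member_le_sum) auto
    then have "p0 k * \<alpha> k \<le> 1 * 1"
      using prior_sum detection_prob[OF that] by (intro mult_mono) auto
    then show ?thesis by (simp add: p_def)
  qed
  then have "certified (\<lambda>_. 0) (\<lambda>_. 1) 1 initial \<and> ready {1..K} (\<lambda>_. 0) 1 initial \<and>
      balanced (\<lambda>_. 0) {} {} {} initial"
    by (auto simp: certified_def ready_def competing_def entries_def balanced_def initial_def
        outflow_def inflow_def)
  then show ?thesis
    unfolding invariant_def by (auto simp: initial_def)
qed

lemma certifiedD:
  assumes "certified u \<pi> c s"
  shows "(m, k) \<in> A \<Longrightarrow> Sink k \<in> eliminated s \<Longrightarrow>
      Source m \<in> eliminated s \<and> \<pi> (Sink k) \<le> \<pi> (Source m)"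
    and "(m, k) \<in> A \<Longrightarrow> Source m \<in> eliminated s \<Longrightarrow> flow s m k > 0 \<Longrightarrow>
      Sink k \<in> eliminated s \<and> \<pi> (Source m) \<le> \<pi> (Sink k)"
    and "v \<in> eliminated s \<Longrightarrow> c \<le> \<pi> v"
    and "Source m \<in> eliminated s \<Longrightarrow> avail s m = 0"
    and "k \<in> {1..K} \<Longrightarrow> Sink k \<in> eliminated s \<Longrightarrow> p k (Suc (u k)) \<le> \<pi> (Sink k)"
    and "k \<in> {1..K} \<Longrightarrow> u k > 0 \<Longrightarrow>
      (if Sink k \<in> eliminated s then \<pi> (Sink k) else c) \<le> p k (u k)"
  using assms unfolding certified_def by (simp_all del: if_split, auto)

lemma searchingD:
  assumes "searching k s"
  shows "distinct (queue s)" "set (queue s) \<inter> visited s = {}"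
    and "reached s \<subseteq> nodes - eliminated s" "Sink k \<in> reached s"
    and "Source m \<in> reached s \<Longrightarrow> avail s m = 0"
    and "(m, k') \<in> A \<Longrightarrow> Sink k' \<in> visited s \<Longrightarrow> Source m \<in> reached s \<union> eliminated s"
    and "(m, k') \<in> A \<Longrightarrow> Source m \<in> visited s \<Longrightarrow> flow s m k' > 0 \<Longrightarrow>
      Sink k' \<in> reached s \<union> eliminated s"
    and "v \<in> reached s \<Longrightarrow> \<exists>vs. search_path (pred s) (flow s) k (v # vs) \<and> set vs \<subseteq> reached s"
  using assms unfolding searching_def by auto

lemma entries_member: "finite S \<Longrightarrow> (k, j) \<in># entries u S \<longleftrightarrow> k \<in> S \<and> j = Suc (u k)"
  by (auto simp: entries_def)

lemma entries_remove:
  assumes "finite S" "k \<in> S"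
  shows "entries u S - {#(k, Suc (u k))#} = entries u (S - {k})"
  using assms by (simp add: entries_def mset_set.remove[of S k])

lemma entries_insert:
  assumes "finite S" "k \<in> S"
  shows "entries u (S - {k}) + {#(k, Suc (Suc (u k)))#} = entries (u(k := Suc (u k))) S"
  using assms by (auto simp: entries_def mset_set.remove[of S k] intro!: image_mset_cong)

lemma competing_finite: "competing S u c s \<Longrightarrow> finite S"
  by (auto simp: competing_def intro: finite_subset)

lemma is_min_entries:
  assumes "is_min (k, j) (entries u S)" "finite S"
  shows "k \<in> S" "j = Suc (u k)" "\<And>k'. k' \<in> S \<Longrightarrow> p k' (Suc (u k')) \<le> p k j"
proof -
  show "k \<in> S" "j = Suc (u k)"
    using assms by (auto simp: is_min_def entries_member)
  fix k' assume "k' \<in> S"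
  then have "key (k, j) \<le> key (k', Suc (u k'))"
    using assms unfolding is_min_def by (metis entries_member)
  then show "p k' (Suc (u k')) \<le> p k j" by simp
qed

lemma size_remove_min: "is_min e H \<Longrightarrow> size (H - {#e#}) < size H"
  by (auto simp: is_min_def size_Diff1_less)

text \<open>
  Extracting the next entry lowers \<open>c\<close>, which only weakens the certificate.
\<close>

lemma certified_antimono:
  "certified u \<pi> c s \<Longrightarrow> c' \<le> c \<Longrightarrow> certified u \<pi> c' s"
  unfolding certified_def by (fastforce split: if_splits)

text \<open>
  Augmenting paths avoid eliminated agents, so no augmentation can disturb prices already fixed.
\<close>

lemma certified_transfer:
  assumes "certified u \<pi> c s" "eliminated s' = eliminated s" "avail s' = avail s"
    and "\<And>m k. Source m \<in> eliminated s \<Longrightarrow> flow s' m k = flow s m k"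
  shows "certified u \<pi> c s'"
  using assms unfolding certified_def by fastforce

lemma serving_transfer:
  "serving k j S u c s \<Longrightarrow> eliminated s' = eliminated s \<Longrightarrow> heap s' = heap s \<Longrightarrow>
   serving k j S u c s'"
  unfolding serving_def competing_def by metis

text \<open>
  The common part of the two kinds of search step; the premise \<open>paths\<close> is what depends on whether
  the expanded node \<open>t\<close> is an agent or a location.
\<close>

lemma searching_extend:
  assumes srch: "searching k s" and qs: "queue s = t # q"
    and new: "distinct ns" "set ns \<inter> reached s = {}" "set ns \<subseteq> nodes - eliminated s"
    and avail0: "\<And>m. Source m \<in> set ns \<Longrightarrow> avail s m = 0"
    and closed_sink: "\<And>m k'. t = Sink k' \<Longrightarrow> (m, k') \<in> A \<Longrightarrow>
        Source m \<in> set ns \<union> reached s \<union> eliminated s"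
    and closed_source: "\<And>m k'. t = Source m \<Longrightarrow> (m, k') \<in> A \<Longrightarrow> flow s m k' > 0 \<Longrightarrow>
        Sink k' \<in> set ns \<union> reached s \<union> eliminated s"
    and paths: "\<And>v vs. v \<in> set ns \<Longrightarrow>
        search_path (set_pred t ns (pred s)) (flow s) k (t # vs) \<Longrightarrow> set vs \<subseteq> reached s \<Longrightarrow>
        search_path (set_pred t ns (pred s)) (flow s) k (v # t # vs)"
  shows "searching k (s\<lparr>queue := q @ ns, pred := set_pred t ns (pred s),
           visited := insert t (visited s)\<rparr>)" (is "searching k ?s'")
proof -
  have r: "reached ?s' = reached s \<union> set ns" and t: "t \<in> reached s"
    using qs by (auto simp: reached_def)
  have old: "\<exists>vs. search_path (set_pred t ns (pred s)) (flow s) k (v # vs) \<and> set vs \<subseteq> reached s"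
    if v: "v \<in> reached s" for v
  proof -
    obtain vs where vs: "search_path (pred s) (flow s) k (v # vs)" "set vs \<subseteq> reached s"
      using srch v unfolding searching_def by blast
    have "search_path (set_pred t ns (pred s)) (flow s) k (v # vs)"
      by (rule search_path_cong[OF vs(1)]) (use vs(2) v new(2) in \<open>auto simp: set_pred_def\<close>)
    with vs(2) show ?thesis by blast
  qed
  have "\<exists>vs. search_path (set_pred t ns (pred s)) (flow s) k (v # vs) \<and> set vs \<subseteq> reached ?s'"
    if v: "v \<in> reached ?s'" for v
  proof (cases "v \<in> reached s")
    case True
    then show ?thesis using old[of v] r by auto
  next
    case False
    then have "v \<in> set ns" using v r by simp
    moreover obtain vs where vs: "search_path (set_pred t ns (pred s)) (flow s) k (t # vs)"
        "set vs \<subseteq> reached s"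
      using old[OF t] by blast
    ultimately have "search_path (set_pred t ns (pred s)) (flow s) k (v # t # vs)"
      using paths by blast
    moreover have "set (t # vs) \<subseteq> reached ?s'" using vs(2) r t by auto
    ultimately show ?thesis by blast
  qed
  moreover have "distinct (q @ ns)" "set (q @ ns) \<inter> insert t (visited s) = {}"
    using srch qs new(1,2) by (auto simp: searching_def reached_def)
  moreover have "\<forall>(m, k')\<in>A. Sink k' \<in> insert t (visited s) \<longrightarrow>
      Source m \<in> reached ?s' \<union> eliminated s"
    using searchingD(6)[OF srch] closed_sink unfolding r by blast
  moreover have "\<forall>(m, k')\<in>A. Source m \<in> insert t (visited s) \<longrightarrow> flow s m k' > 0 \<longrightarrow>
      Sink k' \<in> reached ?s' \<union> eliminated s"
    using searchingD(7)[OF srch] closed_source unfolding r by blast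
  moreover have "reached ?s' \<subseteq> nodes - eliminated s" "Sink k \<in> reached ?s'"
      "\<forall>m. Source m \<in> reached ?s' \<longrightarrow> avail s m = 0"
    using srch new(3) avail0 unfolding r by (auto simp: searching_def)
  ultimately show ?thesis
    unfolding searching_def by simp
qed

text \<open>
  Queue and visited set are disjoint, so every expansion visits a node for the first time.
\<close>

lemma searching_rank:
  assumes "searching k s" "queue s = t # q" "pc s = Search k' j'"
    "visited s' = insert t (visited s)" "avail s' = avail s" "heap s' = heap s" "pc s' = pc s"
  shows "((vs, s'), (vs', s)) \<in> progress_rel"
proof -
  have "t \<in> nodes - visited s"
    using assms(1,2) by (auto simp: searching_def reached_def)
  then have "nodes - visited s' \<subset> nodes - visited s"
    using assms(4) by blast
  then have "card (nodes - visited s') < card (nodes - visited s)"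
    by (intro psubset_card_mono) auto
  then show ?thesis
    using assms by (simp add: progress_rel_def inner_rank_def)
qed

lemma new_sources_fresh:
  assumes "searching k s" "queue s = Sink k' # q" "m \<in> new_sources s k' q"
  shows "(m, k') \<in> A" "Source m \<notin> reached s" "Source m \<in> nodes - eliminated s"
  using assms access_bounds[of m k'] by (auto simp: new_sources_def reached_def nodes_def)

lemma new_sinks_fresh:
  assumes "searching k s" "queue s = Source m # q" "k' \<in> new_sinks s m q"
  shows "(m, k') \<in> A" "flow s m k' > 0" "Sink k' \<notin> reached s" "Sink k' \<in> nodes - eliminated s"
  using assms access_bounds[of m k'] by (auto simp: new_sinks_def reached_def nodes_def)

lemma searching_sink:
  assumes srch: "searching k s" and qs: "queue s = Sink k' # q"
    and ms: "distinct ms" "set ms = new_sources s k' q" "\<forall>m\<in>set ms. avail s m = 0"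
  shows "searching k (s\<lparr>queue := q @ map Source ms,
           pred := set_pred (Sink k') (map Source ms) (pred s),
           visited := insert (Sink k') (visited s)\<rparr>)"
proof (rule searching_extend[OF srch qs])
  note fresh = new_sources_fresh[OF srch qs]
  show "distinct (map Source ms)"
    using ms(1) by (simp add: distinct_map inj_on_def)
  show "set (map Source ms) \<inter> reached s = {}" "set (map Source ms) \<subseteq> nodes - eliminated s"
    using fresh ms(2) by auto
  show "avail s m = 0" if "Source m \<in> set (map Source ms)" for m
    using that ms(3) by auto
  show "Source m \<in> set (map Source ms) \<union> reached s \<union> eliminated s"
    if "Sink k' = Sink k''" "(m, k'') \<in> A" for m k''
    using that ms(2) qs by (auto simp: new_sources_def reached_def)
  fix v vs
  assume v: "v \<in> set (map Source ms)" and vs: "set vs \<subseteq> reached s"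
    and path: "search_path (set_pred (Sink k') (map Source ms) (pred s)) (flow s) k (Sink k' # vs)"
  obtain m where m: "v = Source m" "m \<in> set ms" using v by auto
  show "search_path (set_pred (Sink k') (map Source ms) (pred s)) (flow s) k (v # Sink k' # vs)"
    unfolding m(1) by (rule search_path.source[OF path])
      (use m(2) fresh[of m] ms(2) vs in \<open>auto simp: set_pred_def\<close>)
qed simp

lemma searching_source:
  assumes srch: "searching k s" and qs: "queue s = Source m # q"
    and ks: "distinct ks" "set ks = new_sinks s m q"
  shows "searching k (s\<lparr>queue := q @ map Sink ks,
           pred := set_pred (Source m) (map Sink ks) (pred s),
           visited := insert (Source m) (visited s)\<rparr>)"
proof (rule searching_extend[OF srch qs])
  note fresh = new_sinks_fresh[OF srch qs]
  show "distinct (map Sink ks)"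
    using ks(1) by (simp add: distinct_map inj_on_def)
  show "set (map Sink ks) \<inter> reached s = {}" "set (map Sink ks) \<subseteq> nodes - eliminated s"
    using fresh ks(2) by auto
  show "avail s m = 0" if "Source m \<in> set (map Sink ks)" for m
    using that by auto
  show "Sink k' \<in> set (map Sink ks) \<union> reached s \<union> eliminated s"
    if "Source m = Source m'" "(m', k') \<in> A" "flow s m' k' > 0" for m' k'
    using that ks(2) qs by (auto simp: new_sinks_def reached_def)
  fix v vs
  assume v: "v \<in> set (map Sink ks)" and vs: "set vs \<subseteq> reached s"
    and path: "search_path (set_pred (Source m) (map Sink ks) (pred s)) (flow s) k (Source m # vs)"
  obtain k' where k': "v = Sink k'" "k' \<in> set ks" using v by auto
  show "search_path (set_pred (Source m) (map Sink ks) (pred s)) (flow s) k (v # Source m # vs)"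
    unfolding k'(1) by (rule search_path.sink[OF path])
      (use k'(2) fresh[of k'] ks(2) vs in \<open>auto simp: set_pred_def\<close>)
qed simp

lemma searching_found:
  assumes srch: "searching k s" and qs: "queue s = Sink k' # q"
    and ms: "set (ms @ m # ms') = new_sources s k' q"
  obtains vs where "augmenting k (Source m # vs)
    (s\<lparr>queue := q', pred := set_pred (Sink k') (map Source (ms @ [m])) (pred s), pc := pc'\<rparr>)"
proof -
  let ?ns = "map Source (ms @ [m])"
  have fresh: "(n, k') \<in> A \<and> Source n \<notin> reached s \<and> Source n \<in> nodes - eliminated s"
    if "n \<in> set (ms @ [m])" for n
    using new_sources_fresh[OF srch qs, of n] that ms by auto
  have k': "Sink k' \<in> reached s" using qs by (simp add: reached_def)
  then obtain vs where vs: "search_path (pred s) (flow s) k (Sink k' # vs)" "set vs \<subseteq> reached s"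
    using srch unfolding searching_def by blast
  have "search_path (set_pred (Sink k') ?ns (pred s)) (flow s) k (Sink k' # vs)"
    by (rule search_path_cong[OF vs(1)]) (use vs(2) k' fresh in \<open>auto simp: set_pred_def\<close>)
  then have "search_path (set_pred (Sink k') ?ns (pred s)) (flow s) k (Source m # Sink k' # vs)"
    by (rule search_path.source) (use fresh[of m] vs(2) in \<open>auto simp: set_pred_def\<close>)
  moreover have "set (Source m # Sink k' # vs) \<inter> eliminated s = {}"
    using fresh[of m] k' vs(2) srch by (auto simp: searching_def)
  ultimately show thesis
    using that[of "Sink k' # vs"] by (simp add: augmenting_def)
qed

lemma searching_start:
  assumes "k \<in> {1..K}" "Sink k \<notin> eliminated s"
  shows "searching k (s\<lparr>heap := H, queue := [Sink k], visited := {}, pred := (\<lambda>_. None), pc := c\<rparr>)"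
  using assms by (auto simp: searching_def reached_def nodes_def intro: search_path.root)

text \<open>
  Pricing all visited nodes at \<open>c\<close> keeps the certificate. Prices fixed earlier are at least \<open>c\<close>,
  which is the right direction for an agent eliminated earlier with access to a visited location. The
  opposite combination, a visited agent and an earlier eliminated location, cannot occur, because
  eliminating a location eliminates all agents with access to it.
\<close>

lemma eliminate_visited:
  assumes cert: "certified u \<pi> c s" and srv: "serving k j S u c s"
    and srch: "searching k s" and q: "queue s = []"
  shows "certified u (\<lambda>v. if v \<in> visited s then c else \<pi> v) c
           (s\<lparr>eliminated := eliminated s \<union> visited s, pc := pc'\<rparr>)"
    and "ready (S - {k}) u c (s\<lparr>eliminated := eliminated s \<union> visited s, pc := pc'\<rparr>)"
proof -
  let ?E = "eliminated s" and ?V = "visited s"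
  have r: "reached s = ?V" using q by (simp add: reached_def)
  have V: "?V \<inter> ?E = {}" "Sink k \<in> ?V" "?V \<subseteq> nodes"
    "\<And>m. Source m \<in> ?V \<Longrightarrow> avail s m = 0"
    "\<And>m k'. (m, k') \<in> A \<Longrightarrow> Sink k' \<in> ?V \<Longrightarrow> Source m \<in> ?V \<union> ?E"
    "\<And>m k'. (m, k') \<in> A \<Longrightarrow> Source m \<in> ?V \<Longrightarrow> flow s m k' > 0 \<Longrightarrow> Sink k' \<in> ?V \<union> ?E"
    using searchingD[OF srch] unfolding r by blast+
  note C = certifiedD[OF cert]
  have next_le: "p k' (Suc (u k')) \<le> c" if "Sink k' \<in> ?V" for k'
  proof -
    have "k' \<in> {1..K}" "Sink k' \<notin> ?E" using that V(1,3) by (auto simp: nodes_def)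
    then show ?thesis using srv by (auto simp: serving_def competing_def)
  qed
  have notE: "v \<notin> ?E" if "v \<in> ?V" for v using V(1) that by blast
  let ?\<pi> = "\<lambda>v. if v \<in> ?V then c else \<pi> v"
  have "Source m \<in> ?E \<union> ?V \<and> ?\<pi> (Sink k') \<le> ?\<pi> (Source m)"
    if "(m, k') \<in> A" "Sink k' \<in> ?E \<union> ?V" for m k'
    using that C(1)[of m k'] C(3)[of "Source m"] V(5)[of m k'] notE by auto
  moreover have "Sink k' \<in> ?E \<union> ?V \<and> ?\<pi> (Source m) \<le> ?\<pi> (Sink k')"
    if "(m, k') \<in> A" "Source m \<in> ?E \<union> ?V" "flow s m k' > 0" for m k'
    using that C(2)[of m k'] C(1)[of m k'] C(3)[of "Sink k'"] V(6)[of m k'] notE by auto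
  moreover have "c \<le> ?\<pi> v" if "v \<in> ?E \<union> ?V" for v
    using that C(3) by auto
  moreover have "avail s m = 0" if "Source m \<in> ?E \<union> ?V" for m
    using that C(4) V(4) by auto
  moreover have "p k' (Suc (u k')) \<le> ?\<pi> (Sink k')"
    if "k' \<in> {1..K}" "Sink k' \<in> ?E \<union> ?V" for k'
    using that C(5) next_le by auto
  moreover have "(if Sink k' \<in> ?E \<union> ?V then ?\<pi> (Sink k') else c) \<le> p k' (u k')"
    if "k' \<in> {1..K}" "u k' > 0" for k'
    using C(6)[OF that] notE[of "Sink k'"] by (auto split: if_splits)
  ultimately show "certified u ?\<pi> c (s\<lparr>eliminated := ?E \<union> ?V, pc := pc'\<rparr>)"
    unfolding certified_def by (auto split del: if_split)
  show "ready (S - {k}) u c (s\<lparr>eliminated := ?E \<union> ?V, pc := pc'\<rparr>)"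
    using srv V(2) by (auto simp: ready_def serving_def competing_def)
qed

text \<open>
  The new unit of \<open>k\<close> has value exactly \<open>c\<close>, so it meets the bound on bought units, and the
  following unit is worth at most \<open>c\<close> by monotonicity. The supply of \<open>m\<close> settles the surplus that
  the augmentation left at \<open>m\<close>.
\<close>

lemma serve_unit:
  assumes cert: "certified u \<pi> c s" and srv: "serving k j S u c s"
    and bal: "balanced u {} {m} {k} s" and pos: "avail s m > 0" and m: "m \<in> {1..M}"
    and s': "s' = s\<lparr>avail := (avail s)(m := avail s m - 1), demand := D,
               heap := heap s + {#(k, j + 1)#}, pc := Main\<rparr>"
  shows "certified (u(k := Suc (u k))) \<pi> c s'"
    and "ready S (u(k := Suc (u k))) c s'"
    and "balanced (u(k := Suc (u k))) {} {} {} s'"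
    and "(\<Sum>m = 1..M. avail s' m) < (\<Sum>m = 1..M. avail s m)"
proof -
  have k: "k \<in> S" "S \<subseteq> {1..K}" "Sink k \<notin> eliminated s" "j = Suc (u k)" "c = p k (Suc (u k))"
    using srv by (auto simp: serving_def competing_def)
  show "certified (u(k := Suc (u k))) \<pi> c s'"
    using cert k unfolding s' certified_def by (auto split: if_splits)
  have "p k (Suc (Suc (u k))) \<le> c"
    unfolding k(5) using k(1,2) by (intro p_antimono) auto
  then show "ready S (u(k := Suc (u k))) c s'"
    using srv entries_insert[of S k u] competing_finite[of S u c s]
    unfolding s' by (auto simp: ready_def serving_def competing_def)
  have "outflow (flow s) m' + avail s' m' = N m'" for m'
    using bal pos unfolding balanced_def s' by (cases "m' = m") (auto dest: spec[of _ m'] spec[of _ m])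
  then show "balanced (u(k := Suc (u k))) {} {} {} s'"
    using bal unfolding balanced_def s' by simp
  show "(\<Sum>m = 1..M. avail s' m) < (\<Sum>m = 1..M. avail s m)"
    unfolding s' using pos m by (intro sum_strict_mono_ex1) auto
qed

section \<open>Preservation and progress\<close>

lemma progress_rel_phase:
  "avail s' = avail s \<Longrightarrow> heap s' = heap s \<Longrightarrow> phase (pc s') < phase (pc s) \<Longrightarrow>
   ((vs', s'), (vs, s)) \<in> progress_rel"
  by (simp add: progress_rel_def)

lemma invariant_step:
  assumes inv: "invariant vs s" and st: "step s s'"
  shows "\<exists>vs'. invariant vs' s' \<and> ((vs', s'), (vs, s)) \<in> progress_rel"
proof -
  obtain S u \<pi> c where cert: "certified u \<pi> c s"
    and rest: "case pc s of
       Main \<Rightarrow> ready S u c s \<and> balanced u {} {} {} s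
     | Search k j \<Rightarrow> serving k j S u c s \<and> balanced u {} {} {} s \<and> searching k s
     | AugSource k j m0 m \<Rightarrow> serving k j S u c s \<and> balanced u {m} {m0} {} s \<and>
         m0 \<in> {1..M} \<and> avail s m0 > 0 \<and> hd vs = Source m \<and> augmenting k vs s
     | AugSink k j m0 k' \<Rightarrow> serving k j S u c s \<and> balanced u {} {m0} {k'} s \<and>
         m0 \<in> {1..M} \<and> avail s m0 > 0 \<and> hd vs = Sink k' \<and> augmenting k vs s
     | Return k j r \<Rightarrow> (case r of
           None \<Rightarrow> ready S u c s \<and> balanced u {} {} {} s \<and> visited s \<subseteq> eliminated s
         | Some m \<Rightarrow> serving k j S u c s \<and> balanced u {} {m} {k} s \<and> m \<in> {1..M} \<and> avail s m > 0)
     | Halted \<Rightarrow> ready S u c s \<and> balanced u {} {} {} s \<and> heap s = {#}"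
    using inv unfolding invariant_def by blast
  from st show ?thesis
  proof cases
    case (skip_eliminated k j)
    have rdy: "ready S u c s" and bal: "balanced u {} {} {} s"
      using rest skip_eliminated by auto
    then have fin: "finite S" using competing_finite by (auto simp: ready_def)
    have min: "is_min (k, j) (entries u S)" using rdy skip_eliminated by (simp add: ready_def)
    note kj = is_min_entries[OF min fin]
    have "certified u \<pi> c s'"
      by (rule certified_transfer[OF cert]) (simp_all add: skip_eliminated)
    moreover have "ready (S - {k}) u c s'"
      using rdy kj skip_eliminated entries_remove[OF fin kj(1), of u]
      by (auto simp: ready_def competing_def)
    moreover have "balanced u {} {} {} s'"
      using bal by (simp add: balanced_def skip_eliminated)
    ultimately have "invariant vs s'"
      unfolding invariant_def using skip_eliminated by fastforce
    moreover have "((vs, s'), (vs, s)) \<in> progress_rel"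
      using size_remove_min[of "(k, j)" "heap s"] skip_eliminated by (simp add: progress_rel_def)
    ultimately show ?thesis by blast
  next
    case (call k j)
    have rdy: "ready S u c s" and bal: "balanced u {} {} {} s"
      using rest call by auto
    then have comp: "competing S u c s" and fin: "finite S"
      using competing_finite by (auto simp: ready_def)
    have min: "is_min (k, j) (entries u S)" using rdy call by (simp add: ready_def)
    note kj = is_min_entries[OF min fin]
    have "p k j \<le> c" using comp kj(1,2) by (simp add: competing_def)
    then have "certified u \<pi> (p k j) s" by (rule certified_antimono[OF cert])
    then have "certified u \<pi> (p k j) s'"
      by (rule certified_transfer) (simp_all add: call)
    moreover have "serving k j S u (p k j) s'"
      using rdy kj call entries_remove[OF fin kj(1), of u]
      by (auto simp: ready_def serving_def competing_def)
    moreover have "balanced u {} {} {} s'"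
      using bal by (simp add: balanced_def call)
    moreover have "searching k s'"
      unfolding call(1) using call(4) comp kj(1)
      by (intro searching_start) (auto simp: competing_def)
    ultimately have "invariant vs s'"
      unfolding invariant_def using call by fastforce
    moreover have "((vs, s'), (vs, s)) \<in> progress_rel"
      using size_remove_min[of "(k, j)" "heap s"] call by (simp add: progress_rel_def)
    ultimately show ?thesis by blast
  next
    case (search_sink_found k j k' q ms m ms')
    have srv: "serving k j S u c s" and bal: "balanced u {} {} {} s" and srch: "searching k s"
      using rest search_sink_found by auto
    obtain ws where ws: "augmenting k (Source m # ws) s'"
      using searching_found[OF srch search_sink_found(3,5)] unfolding search_sink_found(1) by blast
    have "m \<in> {1..M}"
      using new_sources_fresh(1)[OF srch search_sink_found(3), of m] search_sink_found(5)
        access_bounds[of m k'] by auto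
    moreover have "certified u \<pi> c s'"
      by (rule certified_transfer[OF cert]) (simp_all add: search_sink_found)
    moreover have "serving k j S u c s'"
      by (rule serving_transfer[OF srv]) (simp_all add: search_sink_found)
    moreover have "balanced u {m} {m} {} s'"
      using bal by (simp add: balanced_def search_sink_found)
    moreover have "avail s' m > 0" "pc s' = AugSource k j m m"
      using search_sink_found by simp_all
    ultimately have "invariant (Source m # ws) s'"
      unfolding invariant_def using ws by fastforce
    moreover have "((Source m # ws, s'), (vs, s)) \<in> progress_rel"
      by (rule progress_rel_phase) (simp_all add: search_sink_found)
    ultimately show ?thesis by blast
  next
    case (search_sink k j k' q ms)
    have srv: "serving k j S u c s" and bal: "balanced u {} {} {} s" and srch: "searching k s"
      using rest search_sink by auto
    have "certified u \<pi> c s'"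
      by (rule certified_transfer[OF cert]) (simp_all add: search_sink)
    moreover have "serving k j S u c s'"
      by (rule serving_transfer[OF srv]) (simp_all add: search_sink)
    moreover have "balanced u {} {} {} s'"
      using bal by (simp add: balanced_def search_sink)
    moreover have "searching k s'"
      unfolding search_sink(1) by (rule searching_sink[OF srch]) (use search_sink in auto)
    moreover have "pc s' = Search k j" by (simp add: search_sink)
    ultimately have "invariant vs s'"
      unfolding invariant_def by fastforce
    moreover have "((vs, s'), (vs, s)) \<in> progress_rel"
      by (rule searching_rank[OF srch search_sink(3,2)]) (simp_all add: search_sink)
    ultimately show ?thesis by blast
  next
    case (search_source k j m q ks)
    have srv: "serving k j S u c s" and bal: "balanced u {} {} {} s" and srch: "searching k s"
      using rest search_source by auto
    have "certified u \<pi> c s'"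
      by (rule certified_transfer[OF cert]) (simp_all add: search_source)
    moreover have "serving k j S u c s'"
      by (rule serving_transfer[OF srv]) (simp_all add: search_source)
    moreover have "balanced u {} {} {} s'"
      using bal by (simp add: balanced_def search_source)
    moreover have "searching k s'"
      unfolding search_source(1) by (rule searching_source[OF srch]) (use search_source in auto)
    moreover have "pc s' = Search k j" by (simp add: search_source)
    ultimately have "invariant vs s'"
      unfolding invariant_def by fastforce
    moreover have "((vs, s'), (vs, s)) \<in> progress_rel"
      by (rule searching_rank[OF srch search_source(3,2)]) (simp_all add: search_source)
    ultimately show ?thesis by blast
  next
    case (search_fail k j)
    have srv: "serving k j S u c s" and bal: "balanced u {} {} {} s" and srch: "searching k s"
      using rest search_fail by auto
    note elim = eliminate_visited[OF cert srv srch search_fail(3), of "Return k j None",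
        folded search_fail(1)]
    have "balanced u {} {} {} s'" "pc s' = Return k j None" "visited s' \<subseteq> eliminated s'"
      using bal by (auto simp: balanced_def search_fail)
    then have "invariant vs s'"
      unfolding invariant_def using elim by fastforce
    moreover have "((vs, s'), (vs, s)) \<in> progress_rel"
      by (rule progress_rel_phase) (simp_all add: search_fail)
    ultimately show ?thesis by blast
  next
    case (augment_source k j m0 m k')
    have srv: "serving k j S u c s" and bal: "balanced u {m} {m0} {} s"
      and m0: "m0 \<in> {1..M}" "avail s m0 > 0" and hd: "hd vs = Source m"
      and aug: "augmenting k vs s"
      using rest augment_source by auto
    from aug have path: "search_path (pred s) (flow s) k vs" and dis: "set vs \<inter> eliminated s = {}"
      by (auto simp: augmenting_def)
    from path obtain ws where vs: "vs = Source m # ws"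
      using hd by (cases rule: search_path.cases) auto
    with path augment_source(3) obtain ws' where ws: "ws = Sink k' # ws'"
      and path': "search_path (pred s) (flow s) k ws" and A: "(m, k') \<in> A"
      by (auto elim: search_path_SourceE)
    have "search_path (pred s) (inc_at m k' (flow s)) k ws"
      by (rule search_path_cong[OF path']) (auto simp: inc_at_def)
    then have "augmenting k ws s'"
      using dis vs by (auto simp: augmenting_def augment_source)
    moreover have "certified u \<pi> c s'"
      by (rule certified_transfer[OF cert])
        (use dis vs in \<open>auto simp: augment_source inc_at_def\<close>)
    moreover have "serving k j S u c s'"
      by (rule serving_transfer[OF srv]) (simp_all add: augment_source)
    moreover have "balanced u {} {m0} {k'} s'"
    proof -
      have "outflow (inc_at m k' (flow s)) n + avail s n = N n + of_bool (n = m0)" for n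
        using bal outflow_inc[OF A, of "flow s" n] unfolding balanced_def by (auto dest: spec[of _ n])
      then show ?thesis
        using bal by (simp add: balanced_def augment_source inflow_inc[OF A])
    qed
    moreover have "pc s' = AugSink k j m0 k'" "avail s' m0 > 0" using m0 by (simp_all add: augment_source)
    ultimately have "invariant ws s'"
      unfolding invariant_def using m0(1) ws by fastforce
    moreover have "((ws, s'), (vs, s)) \<in> progress_rel"
      by (simp add: progress_rel_def inner_rank_def augment_source vs)
    ultimately show ?thesis by blast
  next
    case (augment_sink_end k j m0 k')
    have srv: "serving k j S u c s" and bal: "balanced u {} {m0} {k'} s"
      and m0: "m0 \<in> {1..M}" "avail s m0 > 0" and hd: "hd vs = Sink k'"
      and aug: "augmenting k vs s"
      using rest augment_sink_end by auto
    from aug have "search_path (pred s) (flow s) k vs" by (simp add: augmenting_def)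
    then have "k' = k"
      using hd augment_sink_end(3) by (cases rule: search_path.cases) auto
    then have "balanced u {} {m0} {k} s'"
      using bal by (simp add: balanced_def augment_sink_end)
    moreover have "certified u \<pi> c s'"
      by (rule certified_transfer[OF cert]) (simp_all add: augment_sink_end)
    moreover have "serving k j S u c s'"
      by (rule serving_transfer[OF srv]) (simp_all add: augment_sink_end)
    moreover have "pc s' = Return k j (Some m0)" "avail s' m0 > 0"
      using m0 by (simp_all add: augment_sink_end)
    ultimately have "invariant vs s'"
      unfolding invariant_def using m0(1) by fastforce
    moreover have "((vs, s'), (vs, s)) \<in> progress_rel"
      by (rule progress_rel_phase) (simp_all add: augment_sink_end)
    ultimately show ?thesis by blast
  next
    case (augment_sink k j m0 k' m)
    have srv: "serving k j S u c s" and bal: "balanced u {} {m0} {k'} s"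
      and m0: "m0 \<in> {1..M}" "avail s m0 > 0" and hd: "hd vs = Sink k'"
      and aug: "augmenting k vs s"
      using rest augment_sink by auto
    from aug have path: "search_path (pred s) (flow s) k vs" and dis: "set vs \<inter> eliminated s = {}"
      by (auto simp: augmenting_def)
    from path obtain ws where vs: "vs = Sink k' # ws"
      using hd by (cases rule: search_path.cases) auto
    with path augment_sink(3) obtain ws' where ws: "ws = Source m # ws'"
      and path': "search_path (pred s) (flow s) k ws" and A: "(m, k') \<in> A"
      and fresh: "Sink k' \<notin> set ws"
      by (auto elim: search_path_SinkE)
    have "search_path (pred s) (dec_at m k' (flow s)) k ws"
      by (rule search_path_cong[OF path']) (use fresh in \<open>auto simp: dec_at_def\<close>)
    then have "augmenting k ws s'"
      using dis vs by (auto simp: augmenting_def augment_sink)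
    moreover have "certified u \<pi> c s'"
      by (rule certified_transfer[OF cert])
        (use dis vs ws in \<open>auto simp: augment_sink dec_at_def\<close>)
    moreover have "serving k j S u c s'"
      by (rule serving_transfer[OF srv]) (simp_all add: augment_sink)
    moreover have "balanced u {m} {m0} {} s'"
    proof -
      note dec = outflow_dec[where x = "flow s", OF A augment_sink(4)]
        inflow_dec[where x = "flow s", OF A augment_sink(4)]
      have "outflow (dec_at m k' (flow s)) n + avail s n + of_bool (n = m) = N n + of_bool (n = m0)"
        for n using bal dec(1)[of n] unfolding balanced_def by (auto dest: spec[of _ n])
      moreover have "inflow (dec_at m k' (flow s)) l = u l" for l
        using bal dec(2)[of l] unfolding balanced_def by (auto dest: spec[of _ l])
      ultimately show ?thesis by (simp add: balanced_def augment_sink)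
    qed
    moreover have "pc s' = AugSource k j m0 m" "avail s' m0 > 0" using m0 by (simp_all add: augment_sink)
    ultimately have "invariant ws s'"
      unfolding invariant_def using m0(1) ws by fastforce
    moreover have "((ws, s'), (vs, s)) \<in> progress_rel"
      by (simp add: progress_rel_def inner_rank_def augment_sink vs)
    ultimately show ?thesis by blast
  next
    case (return_found k j m)
    have "serving k j S u c s" "balanced u {} {m} {k} s" "m \<in> {1..M}"
      using rest return_found by auto
    note served = serve_unit[OF cert this(1,2) return_found(3) this(3) return_found(1)]
    have "invariant vs s'"
      unfolding invariant_def using served(1-3) by (auto simp: return_found)
    moreover have "((vs, s'), (vs, s)) \<in> progress_rel"
      using served(4) by (simp add: progress_rel_def)
    ultimately show ?thesis by blast
  next
    case (return_none k j)
    have rdy: "ready S u c s" and bal: "balanced u {} {} {} s" and "visited s \<subseteq> eliminated s"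
      using rest return_none by auto
    then have E: "eliminated s \<union> visited s = eliminated s" by blast
    have "certified u \<pi> c s'"
      by (rule certified_transfer[OF cert]) (simp_all add: return_none E)
    moreover have "ready S u c s'"
      using rdy by (simp add: ready_def competing_def return_none E)
    moreover have "balanced u {} {} {} s'"
      using bal by (simp add: balanced_def return_none)
    moreover have "pc s' = Main" by (simp add: return_none)
    ultimately have "invariant vs s'"
      unfolding invariant_def by fastforce
    moreover have "((vs, s'), (vs, s)) \<in> progress_rel"
      by (rule progress_rel_phase) (simp_all add: return_none)
    ultimately show ?thesis by blast
  next
    case halt
    have rdy: "ready S u c s" and bal: "balanced u {} {} {} s"
      using rest halt by auto
    have "certified u \<pi> c s'"
      by (rule certified_transfer[OF cert]) (simp_all add: halt)
    moreover have "ready S u c s'"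
      using rdy by (simp add: ready_def competing_def halt)
    moreover have "balanced u {} {} {} s'"
      using bal by (simp add: balanced_def halt)
    moreover have "pc s' = Halted" "heap s' = {#}" by (simp_all add: halt)
    ultimately have "invariant vs s'"
      unfolding invariant_def by fastforce
    moreover have "((vs, s'), (vs, s)) \<in> progress_rel"
      by (rule progress_rel_phase) (simp_all add: halt)
    ultimately show ?thesis by blast
  qed
qed

lemma is_min_exists:
  assumes "H \<noteq> {#}"
  obtains k j where "is_min (k, j) H"
proof -
  have "is_min (arg_min_on key (set_mset H)) H"
    using assms arg_min_if_finite(1)[of "set_mset H" key] arg_min_least[of "set_mset H"]
    unfolding is_min_def by auto
  then show thesis using that by (metis surj_pair)
qed

lemma step_exists:
  assumes inv: "invariant vs s" and "pc s \<noteq> Halted"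
  shows "\<exists>s'. step s s'"
proof (cases "pc s")
  case Main
  show ?thesis
  proof (cases "heap s = {#}")
    case True
    then show ?thesis using step.halt[OF Main] by blast
  next
    case False
    then obtain k j where "is_min (k, j) (heap s)" by (rule is_min_exists)
    then show ?thesis using step.skip_eliminated[OF Main] step.call[OF Main] by blast
  qed
next
  case (Search k j)
  show ?thesis
  proof (cases "queue s")
    case Nil
    then show ?thesis using step.search_fail[OF Search] by blast
  next
    case (Cons t q)
    show ?thesis
    proof (cases t)
      case (Source m)
      have "finite (new_sinks s m q)"
        by (rule finite_subset[OF _ finite_sinks[of m]]) (auto simp: new_sinks_def)
      then obtain ks where "distinct ks" "set ks = new_sinks s m q"
        using finite_distinct_list by metis
      then show ?thesis using step.search_source[OF Search] Cons Source by blast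
    next
      case (Sink k')
      have "finite (new_sources s k' q)"
        by (rule finite_subset[OF _ finite_sources[of k']]) (auto simp: new_sources_def)
      then obtain ms where ms: "distinct ms" "set ms = new_sources s k' q"
        using finite_distinct_list by metis
      show ?thesis
      proof (cases "\<exists>m\<in>set ms. avail s m > 0")
        case True
        then obtain ms1 m ms2 where split: "ms = ms1 @ m # ms2" "avail s m > 0"
            "\<forall>m'\<in>set ms1. avail s m' = 0"
          using split_list_first_prop[of ms "\<lambda>m. avail s m > 0"] by auto
        show ?thesis
          using step.search_sink_found[OF Search _ ms[unfolded split(1)] split(3,2)] Cons Sink by blast
      next
        case False
        then have "\<forall>m\<in>set ms. avail s m = 0" by auto
        then show ?thesis using step.search_sink[OF Search _ ms] Cons Sink by blast
      qed
    qed
  qed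
next
  case (AugSource k j m0 m)
  then have "search_path (pred s) (flow s) k vs" "hd vs = Source m"
    using inv by (auto simp: invariant_def augmenting_def)
  then obtain k' where "pred s (Source m) = Some (Sink k')"
    by (cases rule: search_path.cases) auto
  then show ?thesis using step.augment_source[OF AugSource] by blast
next
  case (AugSink k j m0 k')
  then have "search_path (pred s) (flow s) k vs" "hd vs = Sink k'"
    using inv by (auto simp: invariant_def augmenting_def)
  then consider "pred s (Sink k') = None"
    | m where "pred s (Sink k') = Some (Source m)" "flow s m k' > 0"
    by (cases rule: search_path.cases) auto
  then show ?thesis
    using step.augment_sink_end[OF AugSink] step.augment_sink[OF AugSink] by cases blast+
next
  case (Return k j r)
  show ?thesis
  proof (cases r)
    case None
    then show ?thesis using step.return_none Return by blast
  next
    case (Some m)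
    then have "avail s m > 0"
      using inv Return by (auto simp: invariant_def)
    then show ?thesis using step.return_found Return Some by blast
  qed
next
  case Halted
  then show ?thesis using assms(2) by simp
qed

lemma halted_optimal:
  assumes inv: "invariant vs s" and "pc s = Halted"
  shows "optimal_allocation (flow s)"
proof -
  obtain S u \<pi> c where cert: "certified u \<pi> c s" and rdy: "ready S u c s"
    and bal: "balanced u {} {} {} s" and H: "heap s = {#}"
    using assms by (auto simp: invariant_def)
  have "S = {}"
    using rdy H competing_finite[of S u c s]
    by (auto simp: ready_def entries_def mset_set_empty_iff)
  then have sinks: "Sink k \<in> eliminated s" if "k \<in> {1..K}" for k
    using rdy that by (auto simp: ready_def competing_def)
  have C: "Source m \<in> eliminated s \<and> \<pi> (Sink k) \<le> \<pi> (Source m)"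
    "flow s m k > 0 \<Longrightarrow> \<pi> (Source m) \<le> \<pi> (Sink k)" if "(m, k) \<in> A" for m k
    using cert sinks[of k] access_bounds[OF that] that unfolding certified_def by auto
  have out: "outflow (flow s) m = N m" if m: "m \<in> {1..M}" for m
  proof -
    obtain k where "(m, k) \<in> A" using agent_has_access[OF m] by blast
    then have "avail s m = 0" using C(1)[of m k] cert by (auto simp: certified_def)
    then show ?thesis using bal by (auto simp: balanced_def dest: spec[of _ m])
  qed
  have "flow s m k \<le> N m" if "(m, k) \<in> A" for m k
  proof -
    have "flow s m k \<le> outflow (flow s) m"
      unfolding outflow_def using that by (intro member_le_sum) auto
    then show ?thesis using out[of m] access_bounds[OF that] by simp
  qed
  then have "feasible (flow s) u"
    using out bal unfolding feasible_def by (auto simp: outflow_def inflow_def balanced_def)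
  then show ?thesis
  proof (rule optimal_by_prices[where lt = "\<lambda>k. \<pi> (Sink k)" and ls = "\<lambda>m. \<pi> (Source m)"])
    fix k assume k: "k \<in> {1..K}"
    show "p k (Suc (u k)) \<le> \<pi> (Sink k)"
      using certifiedD(5)[OF cert k sinks[OF k]] .
    show "\<pi> (Sink k) \<le> p k (u k)" if "u k > 0"
      using certifiedD(6)[OF cert k that] sinks[OF k] by simp
  qed (use C in auto)
qed

lemma invariant_reachable:
  "step\<^sup>*\<^sup>* initial s \<Longrightarrow> \<exists>vs. invariant vs s"
proof (induction rule: rtranclp_induct)
  case base
  then show ?case using invariant_initial by blast
next
  case (step s s')
  then show ?case using invariant_step by blast
qed

text \<open>
  The remaining augmenting path is not a function of the state alone, so a sequence of such paths is
  chosen along the run to obtain a descending chain.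
\<close>

lemma no_infinite_run:
  assumes "\<sigma> 0 = initial" "\<And>i. step (\<sigma> i) (\<sigma> (Suc i))"
  shows False
proof -
  have "\<exists>g. \<forall>i. invariant (g i) (\<sigma> i) \<and>
      ((g (Suc i), \<sigma> (Suc i)), (g i, \<sigma> i)) \<in> progress_rel"
  proof (rule dependent_nat_choice)
    show "\<exists>vs. invariant vs (\<sigma> 0)"
      using assms(1) invariant_initial by auto
    show "\<exists>vs'. invariant vs' (\<sigma> (Suc i)) \<and>
        ((vs', \<sigma> (Suc i)), (vs, \<sigma> i)) \<in> progress_rel" if "invariant vs (\<sigma> i)" for vs i
      using invariant_step[OF that assms(2)] .
  qed
  then obtain g where "\<forall>i. ((g (Suc i), \<sigma> (Suc i)), (g i, \<sigma> i)) \<in> progress_rel"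
    by blast
  moreover have "wf progress_rel"
    by (simp add: progress_rel_def)
  ultimately show False
    unfolding wf_iff_no_infinite_down_chain by fast
qed

end

theorem mainTheorem2:
  fixes M K :: nat
    and A :: "(nat \<times> nat) set"
    and N :: "nat \<Rightarrow> nat"
    and p0 \<alpha> :: "nat \<Rightarrow> real"
  assumes "search_problem M K A N p0 \<alpha>"
  shows "(\<nexists>\<sigma> :: nat \<Rightarrow> state. \<sigma> 0 = search_problem.initial K N \<and>
             (\<forall>i. search_problem.step M K A p0 \<alpha> (\<sigma> i) (\<sigma> (Suc i))))
       \<and> (\<forall>s. (search_problem.step M K A p0 \<alpha>)\<^sup>*\<^sup>* (search_problem.initial K N) s \<and>
             (\<nexists>s'. search_problem.step M K A p0 \<alpha> s s') \<longrightarrow>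
               pc s = Halted \<and>
               search_problem.optimal_allocation M K A N p0 \<alpha> (flow s))"
proof -
  interpret search_problem M K A N p0 \<alpha> by (rule assms)
  have "pc s = Halted \<and> optimal_allocation (flow s)"
    if "step\<^sup>*\<^sup>* initial s" "\<nexists>s'. step s s'" for s
    using invariant_reachable[OF that(1)] that(2) step_exists halted_optimal by blast
  then show ?thesis
    using no_infinite_run by blast
qed

end
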